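(* Suppose that each $P\in\mathcal{P}$ is supported. Let $\mathfrak{Q}$ be a set-valued map assigning to each market model $S\in\mathcal{S}$ a subset $\mathfrak{Q}(S)\subseteq\mathfrak{P}_c(\Omega)$. Suppose that $\mathfrak{Q}$ is $\lhd$-monotone, strongly $\operatorname{NA}$-preserving, and satisfies the following conditions: - $\mathfrak{Q}(S)$ is countably convex for all $S\in\mathcal{S}$, in the sense that if $(\alpha_n)_{n\in\mathbb{N}}$ is a sequence of non-negative real numbers summing up to $1$ and $Q_n\in\mathfrak{Q}(S)$ for all $n\in\mathbb{N}$, then $\sum_{n\in\mathbb{N}}\alpha_nQ_n\in\mathfrak{Q}(S)$. - $\bigcup_{Q\in\mathfrak{Q}(S)}\mathfrak{M}^Q_\approx(S)\subseteq\mathfrak{Q}(S)\subseteq\mathfrak{M}(S)$ for all $S\in\mathcal{S}$. Then, for any $S\in\mathcal{S}$, the following are equivalent: (i) $\operatorname{NA}(\mathcal{P},S)$ holds. (ii) For all $P\in\mathcal{P}$ there exists $Q\in\mathfrak{Q}(S)$ such that $P\ll Q$.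
   Context: $(\Omega,\mathcal{F})$ is a measurable space and $\mathcal{P}$ is a non-empty set of probability measures on it; $c(A):=\sup_{P\in\mathcal{P}}P(A)$ for $A\in\mathcal{F}$. An event $A\in\mathcal{F}$ is $\mathcal{P}$-polar if $c(A)=0$; a property holds $\mathcal{P}$-q.s. if it holds outside a $\mathcal{P}$-polar event. $\mathfrak{P}_c(\Omega)$ is the set of probability measures on $(\Omega,\mathcal{F})$ vanishing on all $\mathcal{P}$-polar events. $Q\in\mathfrak{P}_c(\Omega)$ is supported if there is $S(Q)\in\mathcal{F}$ such that $Q(S(Q)^c)=0$ and, whenever $N\in\mathcal{F}$ satisfies $Q(N)=0$, $N\cap S(Q)$ is $\mathcal{P}$-polar. Markets: a one-period market model of dimension $d\in\mathbb{N}$ is $S=(S_0,S_1)$ with $S_0\in\mathbb{R}^d$ and $S_1$ a bounded $d$-dimensional random vector on $(\Omega,\mathcal{F})$, all coordinates of $S_0,S_1$ being non-negative; $\mathcal{S}$ is the collection of all such models of all dimensions $d\in\mathbb{N}$; $d(S)$ is the dimension of $S$; $\Delta S:=S_1-S_0$; for $H\in\mathbb{R}^{d(S)}$, $H\Delta S$ is the ($\omega$-wise) Euclidean scalar product. $S\lhd S'$ means that for every $i\in\{1,\dots,d(S)\}$ there is $j\in\{1,\dots,d(S')\}$ with $(S^i_0,S^i_1)=(S'^j_0,S'^j_1)$. $\operatorname{NA}(\mathcal{P},S)$ holds if for all $H\in\mathbb{R}^{d(S)}$, $H\Delta S\ge0$ $\mathcal{P}$-q.s. implies $H\Delta S=0$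 $\mathcal{P}$-q.s. For $Q\in\mathfrak{P}_c(\Omega)$, $\operatorname{NA}(Q,S)$ holds if for all $H\in\mathbb{R}^{d(S)}$, $H\Delta S\ge0$ $Q$-a.s. implies $H\Delta S=0$ $Q$-a.s. $\mathfrak{M}(S):=\{Q\in\mathfrak{P}_c(\Omega)\mid E_Q[\Delta S^i]=0\text{ for all }i=1,\dots,d(S)\}$ is the set of martingale measures for $S$ in $\mathfrak{P}_c(\Omega)$, and $\mathfrak{M}^Q_\approx(S):=\{R\in\mathfrak{M}(S)\mid R\approx Q\}$, where $R\approx Q$ means mutual absolute continuity. $\mathfrak{Q}$ is $\lhd$-monotone if $\mathfrak{Q}(S')\subseteq\mathfrak{Q}(S)$ for all $S,S'\in\mathcal{S}$ with $S\lhd S'$. $\mathfrak{Q}$ is strongly $\operatorname{NA}$-preserving if for any $S\in\mathcal{S}$ satisfying $\operatorname{NA}(\mathcal{P},S)$, $\mathfrak{Q}(S)\neq\emptyset$ and $\operatorname{NA}(Q,S)$ holds for all $Q\in\mathfrak{Q}(S)$. *)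

theory Defs
  imports "HOL-Probability.Probability"
begin

text \<open>Throughout, the measure \<open>M\<close> only serves as the measurable space \<open>(space M, sets M)\<close>;
  its own measure plays no role. \<open>\<P>\<close> is a set of probability measures on it.\<close>

definition prob_measures :: "'a measure \<Rightarrow> 'a measure set" where
  "prob_measures M = {P. prob_space P \<and> sets P = sets M}"

definition upper_prob :: "'a measure set \<Rightarrow> 'a set \<Rightarrow> ennreal" where
  "upper_prob \<P> A = (SUP P\<in>\<P>. emeasure P A)"

definition polar :: "'a measure \<Rightarrow> 'a measure set \<Rightarrow> 'a set \<Rightarrow> bool" where
  "polar M \<P> A \<longleftrightarrow> A \<in> sets M \<and> upper_prob \<P> A = 0"

definition quasi_surely :: "'a measure \<Rightarrow> 'a measure set \<Rightarrow> ('a \<Rightarrow> bool) \<Rightarrow> bool" where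
  "quasi_surely M \<P> \<phi> \<longleftrightarrow> (\<exists>N. polar M \<P> N \<and> (\<forall>\<omega>\<in>space M - N. \<phi> \<omega>))"

definition prob_measures_c :: "'a measure \<Rightarrow> 'a measure set \<Rightarrow> 'a measure set" where
  "prob_measures_c M \<P> = {Q \<in> prob_measures M. \<forall>N. polar M \<P> N \<longrightarrow> emeasure Q N = 0}"

definition supported :: "'a measure \<Rightarrow> 'a measure set \<Rightarrow> 'a measure \<Rightarrow> bool" where
  "supported M \<P> Q \<longleftrightarrow>
     (\<exists>S\<in>sets M. emeasure Q (space M - S) = 0 \<and>
        (\<forall>N\<in>sets M. emeasure Q N = 0 \<longrightarrow> polar M \<P> (N \<inter> S)))"

text \<open>A one-period market model \<open>S\<close> of dimension \<open>d\<close> is the list of its \<open>d\<close> assets, the \<open>i\<close>-th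
  entry (counting from 0) being the pair of the initial price \<open>S\<^sub>0\<^sup>i\<close> and the terminal price
  \<open>S\<^sub>1\<^sup>i\<close>. Lists make the dimension part of the model, so that models of different dimensions
  have a common type.\<close>

type_synonym 'a market = "(real \<times> ('a \<Rightarrow> real)) list"

abbreviation dimension :: "'a market \<Rightarrow> nat" where
  "dimension S \<equiv> length S"

definition price0 :: "'a market \<Rightarrow> nat \<Rightarrow> real" where
  "price0 S i = fst (S ! i)"

definition price1 :: "'a market \<Rightarrow> nat \<Rightarrow> 'a \<Rightarrow> real" where
  "price1 S i = snd (S ! i)"

text \<open>Terminal prices are functions on \<open>space M\<close>. Requiring the value \<open>undefined\<close> elsewhere
  (\<open>extensional\<close>) makes equality of terminal prices the same as equality on \<open>space M\<close>.
  A random vector is bounded iff each of its coordinates is.\<close>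

definition markets :: "'a measure \<Rightarrow> 'a market set" where
  "markets M = {S. dimension S \<ge> 1 \<and>
     (\<forall>i<dimension S.
        price0 S i \<ge> 0 \<and>
        price1 S i \<in> extensional (space M) \<and>
        price1 S i \<in> borel_measurable M \<and>
        bounded (price1 S i ` space M) \<and>
        (\<forall>\<omega>\<in>space M. price1 S i \<omega> \<ge> 0))}"

definition increment :: "'a market \<Rightarrow> nat \<Rightarrow> 'a \<Rightarrow> real" where
  "increment S i \<omega> = price1 S i \<omega> - price0 S i"

text \<open>A strategy \<open>H \<in> \<real>\<^sup>d\<close> is given by a function on \<open>nat\<close> of which only the values at
  \<open>i < d\<close> matter.\<close>

definition gain :: "(nat \<Rightarrow> real) \<Rightarrow> 'a market \<Rightarrow> 'a \<Rightarrow> real" where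
  "gain H S \<omega> = (\<Sum>i<dimension S. H i * increment S i \<omega>)"

definition submarket :: "'a market \<Rightarrow> 'a market \<Rightarrow> bool" (infix "\<lhd>\<^sub>m" 50) where
  "S \<lhd>\<^sub>m S' \<longleftrightarrow>
     (\<forall>i<dimension S. \<exists>j<dimension S'. (price0 S i, price1 S i) = (price0 S' j, price1 S' j))"

definition NA_qs :: "'a measure \<Rightarrow> 'a measure set \<Rightarrow> 'a market \<Rightarrow> bool" where
  "NA_qs M \<P> S \<longleftrightarrow>
     (\<forall>H. quasi_surely M \<P> (\<lambda>\<omega>. gain H S \<omega> \<ge> 0) \<longrightarrow> quasi_surely M \<P> (\<lambda>\<omega>. gain H S \<omega> = 0))"

definition NA :: "'a measure \<Rightarrow> 'a market \<Rightarrow> bool" where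
  "NA Q S \<longleftrightarrow> (\<forall>H. (AE \<omega> in Q. gain H S \<omega> \<ge> 0) \<longrightarrow> (AE \<omega> in Q. gain H S \<omega> = 0))"

definition martingale_measures :: "'a measure \<Rightarrow> 'a measure set \<Rightarrow> 'a market \<Rightarrow> 'a measure set" where
  "martingale_measures M \<P> S =
     {Q \<in> prob_measures_c M \<P>. \<forall>i<dimension S. (\<integral>\<omega>. increment S i \<omega> \<partial>Q) = 0}"

definition equiv_martingale_measures ::
  "'a measure \<Rightarrow> 'a measure set \<Rightarrow> 'a measure \<Rightarrow> 'a market \<Rightarrow> 'a measure set" where
  "equiv_martingale_measures M \<P> Q S =
     {R \<in> martingale_measures M \<P> S. absolutely_continuous Q R \<and> absolutely_continuous R Q}"

definition mixture :: "'a measure \<Rightarrow> (nat \<Rightarrow> real) \<Rightarrow> (nat \<Rightarrow> 'a measure) \<Rightarrow> 'a measure" where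
  "mixture M \<alpha> Q =
     measure_of (space M) (sets M) (\<lambda>A. \<Sum>n. ennreal (\<alpha> n) * emeasure (Q n) A)"

text \<open>\<open>measure_of\<close> yields the null measure for set functions that are not measures;
  the following lemma shows that this does not happen here.\<close>

lemma emeasure_mixture:
  assumes "\<And>n. sets (Q n) = sets M" and "A \<in> sets M"
  shows "emeasure (mixture M \<alpha> Q) A = (\<Sum>n. ennreal (\<alpha> n) * emeasure (Q n) A)"
proof (rule emeasure_measure_of[OF mixture_def])
  show "sets M \<subseteq> Pow (space M)" by (rule sets.space_closed)
  show "A \<in> sets (mixture M \<alpha> Q)"
    using assms(2) by (simp add: mixture_def)
  show "positive (sets (mixture M \<alpha> Q)) (\<lambda>A. \<Sum>n. ennreal (\<alpha> n) * emeasure (Q n) A)"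
    by (simp add: positive_def)
  show "countably_additive (sets (mixture M \<alpha> Q)) (\<lambda>A. \<Sum>n. ennreal (\<alpha> n) * emeasure (Q n) A)"
  proof (rule countably_additiveI)
    fix F :: "nat \<Rightarrow> 'a set"
    assume F: "range F \<subseteq> sets (mixture M \<alpha> Q)" "disjoint_family F"
    have "(\<Sum>i. emeasure (Q n) (F i)) = emeasure (Q n) (\<Union>(range F))" for n
      using F assms(1) by (intro suminf_emeasure) (auto simp: mixture_def)
    then have eq: "(\<Sum>i. ennreal (\<alpha> n) * emeasure (Q n) (F i))
        = ennreal (\<alpha> n) * emeasure (Q n) (\<Union>(range F))" for n
      by simp
    have "(\<Sum>i. \<Sum>n. ennreal (\<alpha> n) * emeasure (Q n) (F i))
        = (\<Sum>i. \<integral>\<^sup>+n. ennreal (\<alpha> n) * emeasure (Q n) (F i) \<partial>count_space UNIV)"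
      by (simp add: nn_integral_count_space_nat)
    also have "\<dots> = (\<integral>\<^sup>+n. (\<Sum>i. ennreal (\<alpha> n) * emeasure (Q n) (F i)) \<partial>count_space UNIV)"
      by (rule nn_integral_suminf[symmetric]) simp
    finally show "(\<Sum>i. \<Sum>n. ennreal (\<alpha> n) * emeasure (Q n) (F i))
        = (\<Sum>n. ennreal (\<alpha> n) * emeasure (Q n) (\<Union>(range F)))"
      by (simp only: eq nn_integral_count_space_nat)
  qed
qed

definition countably_convex :: "'a measure \<Rightarrow> 'a measure set \<Rightarrow> bool" where
  "countably_convex M \<R> \<longleftrightarrow>
     (\<forall>\<alpha> Q. (\<forall>n. \<alpha> n \<ge> 0) \<and> \<alpha> sums 1 \<and> (\<forall>n. Q n \<in> \<R>) \<longrightarrow> mixture M \<alpha> Q \<in> \<R>)"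

definition submarket_monotone :: "'a measure \<Rightarrow> ('a market \<Rightarrow> 'a measure set) \<Rightarrow> bool" where
  "submarket_monotone M \<QQ> \<longleftrightarrow>
     (\<forall>S\<in>markets M. \<forall>S'\<in>markets M. S \<lhd>\<^sub>m S' \<longrightarrow> \<QQ> S' \<subseteq> \<QQ> S)"

definition strongly_NA_preserving ::
  "'a measure \<Rightarrow> 'a measure set \<Rightarrow> ('a market \<Rightarrow> 'a measure set) \<Rightarrow> bool" where
  "strongly_NA_preserving M \<P> \<QQ> \<longleftrightarrow>
     (\<forall>S\<in>markets M. NA_qs M \<P> S \<longrightarrow> \<QQ> S \<noteq> {} \<and> (\<forall>Q\<in>\<QQ> S. NA Q S))"

end

theory Submission
  imports Defs
begin

text \<open>
  If every \<open>P \<in> \<P>\<close> is dominated by some \<open>Q \<in> \<QQ> S\<close>, absence of arbitrage is the classical argument: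
  under the martingale measure \<open>Q\<close> a non-negative gain has expectation zero, hence vanishes
  \<open>Q\<close>-almost surely and so \<open>P\<close>-almost surely.

  The converse rests on the fact that under \<open>NA_qs M \<P> S\<close> every event \<open>A\<close> that is not polar is
  charged by some \<open>Q \<in> \<QQ> S\<close>. To find this \<open>Q\<close>, add to \<open>S\<close> the digital option with payoff
  \<open>indicator A\<close>. It admits a strictly positive price \<open>x\<close> for which the enlarged market \<open>S'\<close> is still
  free of arbitrage (\<open>ex_arbitrage_free_digital_price\<close>). Then \<open>\<QQ> S'\<close> has an element \<open>Q\<close>; it lies in
  \<open>\<QQ> S\<close> by monotonicity, and since it prices the new asset correctly, \<open>Q\<close> gives \<open>A\<close> the
  probability \<open>x > 0\<close>. For the existence of \<open>x\<close>, the only case that needs work is that of a payoff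
  that is not replicable. Then the prices that allow super-hedging and those that allow
  sub-hedging form two disjoint non-empty sets, both closed by
  \<open>closed_superhedging_prices\<close>, and the connected real line is not their union.

  It remains to pass from one measure per event to one measure for all events, as in the theorem of
  Halmos and Savage. Countable mixtures of elements of \<open>\<QQ> S\<close> stay in \<open>\<QQ> S\<close>, so a largest
  set on which \<open>P\<close> is dominated by an element of \<open>\<QQ> S\<close> is obtained by exhaustion. Their argument
  requires a reference measure that dominates all \<open>Q \<in> \<QQ> S\<close>, which need not exist here.
  The support of \<open>P\<close> replaces it: \<open>P\<close>-null subsets of the support are polar, so there all elements of \<open>\<QQ> S\<close>
  are dominated by \<open>P\<close> itself (\<open>dominating_measure_of_countably_convex\<close>).
\<close>

section \<open>Quasi-sure statements and gains\<close>

lemma prob_measuresD: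
  assumes "P \<in> prob_measures M"
  shows "prob_space P" "sets P = sets M" "space P = space M"
proof -
  show "prob_space P" "sets P = sets M" using assms by (auto simp: prob_measures_def)
  then show "space P = space M" by (intro sets_eq_imp_space_eq)
qed

text \<open>For measurable properties the exceptional polar set can be taken to be the set where the
  property fails. Quasi-sure reasoning thus becomes almost-sure reasoning for each \<open>P\<close> separately.\<close>

lemma quasi_surely_iff_AE:
  assumes "\<P> \<subseteq> prob_measures M" and "{\<omega>\<in>space M. \<phi> \<omega>} \<in> sets M"
  shows "quasi_surely M \<P> \<phi> \<longleftrightarrow> (\<forall>P\<in>\<P>. AE \<omega> in P. \<phi> \<omega>)"
proof
  assume "quasi_surely M \<P> \<phi>"
  then obtain N where N: "polar M \<P> N" "\<forall>\<omega>\<in>space M - N. \<phi> \<omega>"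
    unfolding quasi_surely_def by blast
  show "\<forall>P\<in>\<P>. AE \<omega> in P. \<phi> \<omega>"
  proof
    fix P assume P: "P \<in> \<P>"
    then have s: "sets P = sets M" using assms(1) by (auto simp: prob_measures_def)
    have "emeasure P N \<le> 0"
      using N(1) P unfolding polar_def upper_prob_def by (metis SUP_upper)
    then show "AE \<omega> in P. \<phi> \<omega>"
      using N s by (intro AE_I[of _ _ N]) (auto simp: polar_def sets_eq_imp_space_eq[OF s])
  qed
next
  assume ae: "\<forall>P\<in>\<P>. AE \<omega> in P. \<phi> \<omega>"
  let ?N = "{\<omega>\<in>space M. \<not> \<phi> \<omega>}"
  have "?N = space M - {\<omega>\<in>space M. \<phi> \<omega>}" by auto
  then have N: "?N \<in> sets M" using assms(2) by (metis sets.compl_sets)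
  have "emeasure P ?N = 0" if P: "P \<in> \<P>" for P
  proof -
    have s: "sets P = sets M" using assms(1) P by (auto simp: prob_measures_def)
    then have "?N = {\<omega>\<in>space P. \<not> \<phi> \<omega>}" by (simp add: sets_eq_imp_space_eq[OF s])
    moreover have "AE \<omega> in P. \<phi> \<omega>" using ae P by blast
    ultimately show ?thesis using N s by (simp add: AE_iff_measurable)
  qed
  then have "upper_prob \<P> ?N \<le> 0" unfolding upper_prob_def by (intro SUP_least) simp
  then have "upper_prob \<P> ?N = 0" by simp
  then show "quasi_surely M \<P> \<phi>"
    using N unfolding quasi_surely_def polar_def by blast
qed

lemma gain_add_scaled: "gain (\<lambda>i. H i + c * K i) S \<omega> = gain H S \<omega> + c * gain K S \<omega>"
  unfolding gain_def by (simp add: sum.distrib sum_distrib_left algebra_simps)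

lemma gain_scale: "gain (\<lambda>i. a * H i) S \<omega> = a * gain H S \<omega>"
  unfolding gain_def by (simp add: sum_distrib_left algebra_simps)

lemma gain_cong:
  assumes "\<And>i. i < dimension S \<Longrightarrow> H i = K i"
  shows "gain H S \<omega> = gain K S \<omega>"
  unfolding gain_def using assms by (intro sum.cong) auto

lemma increment_measurable:
  assumes "S \<in> markets M" and "i < dimension S"
  shows "increment S i \<in> borel_measurable M"
proof -
  have "price1 S i \<in> borel_measurable M" using assms by (auto simp: markets_def)
  moreover have "increment S i = (\<lambda>\<omega>. price1 S i \<omega> - price0 S i)"
    by (auto simp: increment_def)
  ultimately show ?thesis by simp
qed

lemma gain_measurable:
  assumes "S \<in> markets M"
  shows "gain H S \<in> borel_measurable M"
proof -
  have "gain H S = (\<lambda>\<omega>. \<Sum>i<dimension S. H i * increment S i \<omega>)"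
    by (auto simp: gain_def)
  then show ?thesis using increment_measurable[OF assms] by auto
qed

lemma NA_qs_iff_AE:
  assumes "\<P> \<subseteq> prob_measures M" and "S \<in> markets M"
  shows "NA_qs M \<P> S \<longleftrightarrow>
    (\<forall>H. (\<forall>P\<in>\<P>. AE \<omega> in P. gain H S \<omega> \<ge> 0) \<longrightarrow> (\<forall>P\<in>\<P>. AE \<omega> in P. gain H S \<omega> = 0))"
proof -
  have "{\<omega>\<in>space M. gain H S \<omega> \<ge> 0} \<in> sets M" "{\<omega>\<in>space M. gain H S \<omega> = 0} \<in> sets M" for H
    using gain_measurable[OF assms(2), of H] by measurable
  then show ?thesis unfolding NA_qs_def by (simp add: quasi_surely_iff_AE[OF assms(1)])
qed

section \<open>Closedness of the set of super-hedging prices\<close>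

text \<open>Modulo \<open>\<P>\<close>-null sets, the gains form a vector space spanned by the increments; a
  spanning set of assets of least cardinality is linearly independent. Strategies supported
  on such a basis are determined by their gains, so that a limit strategy with gain zero must be
  zero.\<close>

lemma nonredundant_assets:
  obtains I where "I \<subseteq> {..<dimension S}"
    and "\<And>H. \<exists>K. (\<forall>i. i \<notin> I \<longrightarrow> K i = 0) \<and> (\<forall>P\<in>\<P>. AE \<omega> in P. gain K S \<omega> = gain H S \<omega>)"
    and "\<And>K i. (\<forall>i. i \<notin> I \<longrightarrow> K i = 0) \<Longrightarrow> (\<forall>P\<in>\<P>. AE \<omega> in P. gain K S \<omega> = 0) \<Longrightarrow> K i = 0"
proof -
  define spans where "spans I \<longleftrightarrow> I \<subseteq> {..<dimension S} \<and>
    (\<forall>H. \<exists>K. (\<forall>i. i \<notin> I \<longrightarrow> K i = 0) \<and> (\<forall>P\<in>\<P>. AE \<omega> in P. gain K S \<omega> = gain H S \<omega>))" for I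
  have "spans {..<dimension S}"
    unfolding spans_def
  proof (intro conjI allI subset_refl)
    fix H
    show "\<exists>K. (\<forall>i. i \<notin> {..<dimension S} \<longrightarrow> K i = 0) \<and>
      (\<forall>P\<in>\<P>. AE \<omega> in P. gain K S \<omega> = gain H S \<omega>)"
      by (rule exI[of _ "\<lambda>i. if i < dimension S then H i else 0"]) (auto simp: gain_def)
  qed
  then obtain I where I: "spans I" and min: "\<And>J. spans J \<Longrightarrow> card I \<le> card J"
    using ex_has_least_nat[of spans _ card] by blast
  show thesis
  proof (rule that[of I])
    show "I \<subseteq> {..<dimension S}" using I by (simp add: spans_def)
    show "\<exists>K. (\<forall>i. i \<notin> I \<longrightarrow> K i = 0) \<and> (\<forall>P\<in>\<P>. AE \<omega> in P. gain K S \<omega> = gain H S \<omega>)" for H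
      using I by (simp add: spans_def)
    fix K i
    assume K: "\<forall>i. i \<notin> I \<longrightarrow> K i = 0" "\<forall>P\<in>\<P>. AE \<omega> in P. gain K S \<omega> = 0"
    show "K i = 0"
    proof (rule ccontr)
      assume Ki: "K i \<noteq> 0"
      then have i: "i \<in> I" using K(1) by blast
      have "spans (I - {i})"
        unfolding spans_def
      proof (intro conjI allI)
        show "I - {i} \<subseteq> {..<dimension S}" using I by (auto simp: spans_def)
        fix H
        obtain H' where H': "\<forall>i. i \<notin> I \<longrightarrow> H' i = 0"
          "\<forall>P\<in>\<P>. AE \<omega> in P. gain H' S \<omega> = gain H S \<omega>"
          using I unfolding spans_def by blast
        \<comment> \<open>Subtracting a multiple of the gainless \<open>K\<close> clears the position in asset \<open>i\<close>.\<close>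
        define J where "J = (\<lambda>j. H' j + (- (H' i / K i)) * K j)"
        have gain_J: "gain J S \<omega> = gain H' S \<omega> + (- (H' i / K i)) * gain K S \<omega>" for \<omega>
          unfolding J_def by (rule gain_add_scaled)
        have "AE \<omega> in P. gain J S \<omega> = gain H S \<omega>" if "P \<in> \<P>" for P
        proof -
          have "AE \<omega> in P. gain H' S \<omega> = gain H S \<omega>" "AE \<omega> in P. gain K S \<omega> = 0"
            using H'(2) K(2) that by auto
          then show ?thesis by eventually_elim (simp add: gain_J)
        qed
        moreover have "J j = 0" if "j \<notin> I - {i}" for j
          using that H'(1) K(1) Ki by (cases "j = i") (auto simp: J_def)
        ultimately show "\<exists>K. (\<forall>j. j \<notin> I - {i} \<longrightarrow> K j = 0) \<and>
          (\<forall>P\<in>\<P>. AE \<omega> in P. gain K S \<omega> = gain H S \<omega>)" by blast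
      qed
      from min[OF this] show False
        using i I card_Diff1_less[of I i] finite_subset[of I "{..<dimension S}"]
        by (auto simp: spans_def)
    qed
  qed
qed

text \<open>The usual compactness argument. Given prices \<open>X n\<close> converging to \<open>x\<close>, super-hedging
  strategies in non-redundant assets, once scaled to norm one together with the coefficient of the
  claim, have a convergent subsequence. If the limiting coefficient of the claim
  is positive, dividing by it gives a super-hedge at price \<open>x\<close>. If it is zero, the strategies have
  escaped to infinity, and their limiting direction has non-negative gain; absence of arbitrage
  makes that gain zero, and non-redundancy makes the direction zero, contradicting norm one.
  The payoff \<open>f\<close> is arbitrary, so that applying this to \<open>- f\<close> covers
  sub-hedging.\<close>

lemma closed_superhedging_prices:
  fixes f :: "'a \<Rightarrow> real"
  assumes NA: "\<And>H. \<forall>P\<in>\<P>. AE \<omega> in P. gain H S \<omega> \<ge> 0 \<Longrightarrow> \<forall>P\<in>\<P>. AE \<omega> in P. gain H S \<omega> = 0"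
  shows "closed {x. \<exists>H. \<forall>P\<in>\<P>. AE \<omega> in P. gain H S \<omega> + x \<ge> f \<omega>}" (is "closed ?C")
  unfolding closed_sequential_limits
proof (intro allI impI, elim conjE)
  fix X x
  assume X: "\<forall>n. X n \<in> ?C" and lim: "X \<longlonglongrightarrow> x"
  obtain I where I: "I \<subseteq> {..<dimension S}"
    and Ispan: "\<And>H. \<exists>K. (\<forall>i. i \<notin> I \<longrightarrow> K i = 0) \<and> (\<forall>P\<in>\<P>. AE \<omega> in P. gain K S \<omega> = gain H S \<omega>)"
    and Iind: "\<And>K i. (\<forall>i. i \<notin> I \<longrightarrow> K i = 0) \<Longrightarrow> (\<forall>P\<in>\<P>. AE \<omega> in P. gain K S \<omega> = 0) \<Longrightarrow> K i = 0"
    by (rule nonredundant_assets[of S \<P>]) blast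
  have "\<exists>K. (\<forall>i. i \<notin> I \<longrightarrow> K i = 0) \<and> (\<forall>P\<in>\<P>. AE \<omega> in P. gain K S \<omega> + X n \<ge> f \<omega>)" for n
  proof -
    obtain H where H: "\<forall>P\<in>\<P>. AE \<omega> in P. gain H S \<omega> + X n \<ge> f \<omega>" using X by blast
    obtain K where K: "\<forall>i. i \<notin> I \<longrightarrow> K i = 0" "\<forall>P\<in>\<P>. AE \<omega> in P. gain K S \<omega> = gain H S \<omega>"
      using Ispan by blast
    have "AE \<omega> in P. gain K S \<omega> + X n \<ge> f \<omega>" if "P \<in> \<P>" for P
      using bspec[OF H that] bspec[OF K(2) that] by eventually_elim simp
    then show ?thesis using K(1) by blast
  qed
  then obtain K where K0: "\<And>n i. i \<notin> I \<Longrightarrow> K n i = 0"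
    and K: "\<And>n P. P \<in> \<P> \<Longrightarrow> AE \<omega> in P. gain (K n) S \<omega> + X n \<ge> f \<omega>"
    by metis
  \<comment> \<open>The coefficient of the claim is stored at the index \<open>d\<close>, which gains in \<open>S\<close> ignore.\<close>
  define d where "d = dimension S"
  define J where "J = insert d I"
  have fin: "finite I" "finite J" using I finite_subset unfolding J_def by auto
  have dI: "d \<notin> I" using I by (auto simp: d_def)
  define G where "G n = (K n)(d := 1)" for n
  define s where "s n = (\<Sum>i\<in>J. \<bar>G n i\<bar>)" for n
  define F where "F n i = G n i / s n" for n i
  have s1: "s n \<ge> 1" for n
  proof -
    have "\<bar>G n d\<bar> \<le> s n" unfolding s_def by (rule member_le_sum) (auto simp: J_def fin)
    then show ?thesis by (simp add: G_def)
  qed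
  then have spos: "s n > 0" for n using less_le_trans zero_less_one by blast
  have F0: "F n i = 0" if "i \<notin> J" for n i using that K0 by (auto simp: F_def G_def J_def)
  have Fsum: "(\<Sum>i\<in>J. \<bar>F n i\<bar>) = 1" for n
    using spos[of n] by (simp add: F_def sum_divide_distrib[symmetric] s_def[symmetric])
  have Fb: "\<bar>F n i\<bar> \<le> 1" if "i \<in> J" for n i
    using member_le_sum[OF that, of "\<lambda>i. \<bar>F n i\<bar>"] fin Fsum[of n] by simp
  have FAE: "AE \<omega> in P. gain (F n) S \<omega> + F n d * X n \<ge> F n d * f \<omega>" if "P \<in> \<P>" for n P
    using K[OF that, of n]
  proof eventually_elim
    fix \<omega> assume le: "gain (K n) S \<omega> + X n \<ge> f \<omega>"
    have "gain (F n) S \<omega> = gain (\<lambda>i. inverse (s n) * K n i) S \<omega>"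
      by (rule gain_cong) (simp add: F_def G_def d_def field_simps)
    also have "\<dots> = inverse (s n) * gain (K n) S \<omega>" by (rule gain_scale)
    finally have *: "gain (F n) S \<omega> = inverse (s n) * gain (K n) S \<omega>" .
    have "F n d = inverse (s n)" by (simp add: F_def G_def field_simps)
    moreover have "inverse (s n) * f \<omega> \<le> inverse (s n) * (gain (K n) S \<omega> + X n)"
      using le spos[of n] by (intro mult_left_mono) auto
    ultimately show "gain (F n) S \<omega> + F n d * X n \<ge> F n d * f \<omega>"
      using * by (simp add: algebra_simps)
  qed
  obtain l r where r: "strict_mono (r :: nat \<Rightarrow> nat)"
    and l: "\<forall>e>0. eventually (\<lambda>n. \<forall>i\<in>J. dist (F (r n) i) (l i) < e) sequentially"
  proof -
    have "bounded ((\<lambda>x. x k) ` range F)" if "k \<in> J" for k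
      using Fb[OF that] by (intro boundedI[of _ 1]) auto
    then have "\<forall>d\<subseteq>J. \<exists>l. \<exists>r::nat \<Rightarrow> nat. strict_mono r \<and>
      (\<forall>e>0. eventually (\<lambda>n. \<forall>i\<in>d. dist (F (r n) i) (l i) < e) sequentially)"
      by (intro compact_lemma_general[where proj="\<lambda>x k. x k" and unproj="\<lambda>x. x"] fin) auto
    then show thesis using that by blast
  qed
  define L where "L i = (if i \<in> J then l i else 0)" for i
  have FL: "(\<lambda>n. F (r n) i) \<longlonglongrightarrow> L i" for i
  proof (cases "i \<in> J")
    case True
    show ?thesis
    proof (rule tendstoI)
      fix e :: real assume "e > 0"
      then show "\<forall>\<^sub>F n in sequentially. dist (F (r n) i) (L i) < e"
        using spec[OF l, of e] True by (auto simp: L_def elim: eventually_mono)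
    qed
  qed (simp add: L_def F0)
  have Lsum: "(\<Sum>i\<in>J. \<bar>L i\<bar>) = 1"
  proof (rule LIMSEQ_unique)
    show "(\<lambda>n. \<Sum>i\<in>J. \<bar>F (r n) i\<bar>) \<longlonglongrightarrow> (\<Sum>i\<in>J. \<bar>L i\<bar>)"
      by (intro tendsto_intros FL)
    show "(\<lambda>n. \<Sum>i\<in>J. \<bar>F (r n) i\<bar>) \<longlonglongrightarrow> 1" by (simp add: Fsum)
  qed
  have Ld: "L d \<ge> 0"
    using FL[of d] by (rule LIMSEQ_le_const) (use spos in \<open>auto simp: F_def G_def less_imp_le\<close>)
  have Xr: "(\<lambda>n. X (r n)) \<longlonglongrightarrow> x" using LIMSEQ_subseq_LIMSEQ[OF lim r] by (simp add: o_def)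
  have LAE: "AE \<omega> in P. gain L S \<omega> + L d * x \<ge> L d * f \<omega>" if "P \<in> \<P>" for P
  proof -
    have "AE \<omega> in P. \<forall>n. gain (F n) S \<omega> + F n d * X n \<ge> F n d * f \<omega>"
      using FAE[OF that] by (simp add: AE_all_countable)
    then show ?thesis
    proof eventually_elim
      fix \<omega> assume le: "\<forall>n. gain (F n) S \<omega> + F n d * X n \<ge> F n d * f \<omega>"
      have "(\<lambda>n. gain (F (r n)) S \<omega> + F (r n) d * X (r n)) \<longlonglongrightarrow> gain L S \<omega> + L d * x"
        unfolding gain_def by (intro tendsto_intros FL Xr)
      moreover have "(\<lambda>n. F (r n) d * f \<omega>) \<longlonglongrightarrow> L d * f \<omega>" by (intro tendsto_intros FL)
      ultimately show "gain L S \<omega> + L d * x \<ge> L d * f \<omega>"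
        using le by (intro LIMSEQ_le) auto
    qed
  qed
  show "x \<in> ?C"
  proof (cases "L d = 0")
    case True
    then have "\<forall>P\<in>\<P>. AE \<omega> in P. gain L S \<omega> \<ge> 0" using LAE by simp
    then have "\<forall>P\<in>\<P>. AE \<omega> in P. gain L S \<omega> = 0" by (rule NA)
    moreover have "\<forall>i. i \<notin> I \<longrightarrow> L i = 0" using True by (auto simp: L_def J_def)
    ultimately have "L i = 0" for i using Iind by blast
    then show ?thesis using Lsum by simp
  next
    case False
    then have Lp: "L d > 0" using Ld by simp
    have "AE \<omega> in P. gain (\<lambda>i. inverse (L d) * L i) S \<omega> + x \<ge> f \<omega>" if "P \<in> \<P>" for P
      using LAE[OF that] unfolding gain_scale
      by eventually_elim (use Lp in \<open>simp add: field_simps\<close>)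
    then show ?thesis by blast
  qed
qed

section \<open>Arbitrage-free prices for a digital option\<close>

text \<open>The payoff is restricted to \<open>space M\<close> because terminal prices of a market are extensional.\<close>

definition digital_extension :: "'a measure \<Rightarrow> 'a market \<Rightarrow> 'a set \<Rightarrow> real \<Rightarrow> 'a market" where
  "digital_extension M S A x = S @ [(x, restrict (indicator A) (space M))]"

lemma submarket_digital_extension: "S \<lhd>\<^sub>m digital_extension M S A x"
  unfolding submarket_def
proof (intro allI impI)
  fix i assume "i < dimension S"
  then show "\<exists>j<dimension (digital_extension M S A x). (price0 S i, price1 S i) =
      (price0 (digital_extension M S A x) j, price1 (digital_extension M S A x) j)"
    by (intro exI[of _ i]) (auto simp: digital_extension_def price0_def price1_def nth_append)
qed

lemma digital_extension_in_markets:
  assumes "S \<in> markets M" and "A \<in> sets M" and "x \<ge> 0"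
  shows "digital_extension M S A x \<in> markets M"
proof -
  have "restrict (indicator A) (space M) \<in> borel_measurable M"
    using assms(2) by (simp cong: measurable_cong)
  moreover have "bounded (restrict (indicator A :: 'a \<Rightarrow> real) (space M) ` space M)"
    by (intro boundedI[of _ 1]) (auto simp: indicator_def)
  ultimately show ?thesis
    using assms unfolding markets_def digital_extension_def price0_def price1_def
    by (auto simp: nth_append less_Suc_eq)
qed

lemma gain_digital_extension:
  assumes "\<omega> \<in> space M"
  shows "gain H (digital_extension M S A x) \<omega> =
    gain H S \<omega> + H (dimension S) * (indicator A \<omega> - x)"
  using assms
  by (simp add: gain_def digital_extension_def increment_def price0_def price1_def nth_append)

text \<open>An arbitrage in the extended market must trade the option, and scaling the position to one
  unit turns it into a sub-hedge (if bought) or a super-hedge (if sold) at price \<open>x\<close>. Hence any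
  price outside the sets \<open>L\<close> and \<open>U\<close> of sub- and super-hedging prices works. These sets
  are disjoint unless the option is replicable, since a sub- and a super-hedge at the same price add
  up to a non-negative, hence vanishing, gain. A replicable option is priced by its
  replication cost; this is positive, because otherwise the replicating strategy would
  gain at least \<open>indicator A\<close>, which is an arbitrage.\<close>

lemma ex_arbitrage_free_digital_price:
  assumes PM: "\<P> \<subseteq> prob_measures M" and S: "S \<in> markets M" and NA: "NA_qs M \<P> S"
    and A: "A \<in> sets M" and P0: "P0 \<in> \<P>" "emeasure P0 A \<noteq> 0"
  shows "\<exists>x>0. NA_qs M \<P> (digital_extension M S A x)"
proof -
  let ?f = "indicator A :: 'a \<Rightarrow> real"
  have na: "\<forall>P\<in>\<P>. AE \<omega> in P. gain H S \<omega> = 0" if "\<forall>P\<in>\<P>. AE \<omega> in P. gain H S \<omega> \<ge> 0" for H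
    using NA that by (simp add: NA_qs_iff_AE[OF PM S])
  have sp: "space P = space M" "sets P = sets M" if "P \<in> \<P>" for P
    using PM that prob_measuresD[of P M] by auto
  have not0: False if "\<forall>P\<in>\<P>. AE \<omega> in P. ?f \<omega> \<le> 0"
  proof -
    have "AE \<omega> in P0. \<omega> \<notin> A" using bspec[OF that P0(1)]
      by eventually_elim (auto simp: indicator_def split: if_splits)
    then show False using P0(2) A sp(2)[OF P0(1)] AE_iff_null_sets[of A P0]
      by (simp add: null_sets_def)
  qed
  have NAext: "NA_qs M \<P> (digital_extension M S A x)"
    if "x > 0" and *: "\<And>H. \<forall>P\<in>\<P>. AE \<omega> in P. gain H S \<omega> + H (dimension S) * (?f \<omega> - x) \<ge> 0 \<Longrightarrow>
      \<forall>P\<in>\<P>. AE \<omega> in P. gain H S \<omega> + H (dimension S) * (?f \<omega> - x) = 0" for x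
  proof -
    have m: "digital_extension M S A x \<in> markets M"
      using digital_extension_in_markets[OF S A] \<open>x > 0\<close> by simp
    have eq: "(AE \<omega> in P. \<phi> (gain H (digital_extension M S A x) \<omega>)) \<longleftrightarrow>
        (AE \<omega> in P. \<phi> (gain H S \<omega> + H (dimension S) * (?f \<omega> - x)))" if "P \<in> \<P>" for P H \<phi>
      by (rule AE_cong) (simp add: sp[OF that] gain_digital_extension)
    show ?thesis
      unfolding NA_qs_iff_AE[OF PM m] using * by (simp add: eq[where \<phi>="\<lambda>y. y \<ge> 0"] eq[where \<phi>="\<lambda>y. y = 0"])
  qed
  show ?thesis
  proof (cases "\<exists>x K. \<forall>P\<in>\<P>. AE \<omega> in P. gain K S \<omega> + x = ?f \<omega>")
    case True
    then obtain x K where rep: "\<And>P. P \<in> \<P> \<Longrightarrow> AE \<omega> in P. gain K S \<omega> + x = ?f \<omega>" by blast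
    have "x > 0"
    proof (rule ccontr)
      assume x: "\<not> x > 0"
      have "\<forall>P\<in>\<P>. AE \<omega> in P. gain K S \<omega> \<ge> 0"
      proof
        fix P assume "P \<in> \<P>"
        from rep[OF this] show "AE \<omega> in P. gain K S \<omega> \<ge> 0"
        proof eventually_elim
          fix \<omega> assume "gain K S \<omega> + x = ?f \<omega>"
          then show "gain K S \<omega> \<ge> 0"
            using x by (cases "\<omega> \<in> A") auto
        qed
      qed
      then have K0: "\<forall>P\<in>\<P>. AE \<omega> in P. gain K S \<omega> = 0" by (rule na)
      have "\<forall>P\<in>\<P>. AE \<omega> in P. ?f \<omega> \<le> 0"
      proof
        fix P assume "P \<in> \<P>"
        from rep[OF this] bspec[OF K0 this] show "AE \<omega> in P. ?f \<omega> \<le> 0"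
          by eventually_elim (use x in simp)
      qed
      then show False by (rule not0)
    qed
    moreover have "NA_qs M \<P> (digital_extension M S A x)"
    proof (rule NAext[OF \<open>x > 0\<close>])
      fix H :: "nat \<Rightarrow> real"
      define c where "c = H (dimension S)"
      let ?G = "\<lambda>i. H i + c * K i"
      have eq: "AE \<omega> in P. gain H S \<omega> + c * (?f \<omega> - x) = gain ?G S \<omega>" if "P \<in> \<P>" for P
        using rep[OF that] unfolding gain_add_scaled
      proof eventually_elim
        case (elim \<omega>)
        then have "gain K S \<omega> = ?f \<omega> - x" by simp
        then show ?case by simp
      qed
      assume "\<forall>P\<in>\<P>. AE \<omega> in P. gain H S \<omega> + H (dimension S) * (?f \<omega> - x) \<ge> 0"
      then have ge: "\<And>P. P \<in> \<P> \<Longrightarrow> AE \<omega> in P. gain H S \<omega> + c * (?f \<omega> - x) \<ge> 0"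
        by (simp add: c_def)
      have "AE \<omega> in P. gain ?G S \<omega> \<ge> 0" if "P \<in> \<P>" for P
        using eq[OF that] ge[OF that] by eventually_elim simp
      then have G0: "\<forall>P\<in>\<P>. AE \<omega> in P. gain ?G S \<omega> = 0" by (intro na) blast
      have "AE \<omega> in P. gain H S \<omega> + c * (?f \<omega> - x) = 0" if "P \<in> \<P>" for P
        using eq[OF that] bspec[OF G0 that] by eventually_elim simp
      then show "\<forall>P\<in>\<P>. AE \<omega> in P. gain H S \<omega> + H (dimension S) * (?f \<omega> - x) = 0"
        by (simp add: c_def)
    qed
    ultimately show ?thesis by blast
  next
    case False
    define U where "U = {x. \<exists>H. \<forall>P\<in>\<P>. AE \<omega> in P. gain H S \<omega> + x \<ge> ?f \<omega>}"
    define L where "L = uminus ` {x. \<exists>H. \<forall>P\<in>\<P>. AE \<omega> in P. gain H S \<omega> + x \<ge> - ?f \<omega>}"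
    have L_iff: "x \<in> L \<longleftrightarrow> (\<exists>H. \<forall>P\<in>\<P>. AE \<omega> in P. gain H S \<omega> + ?f \<omega> \<ge> x)" for x
    proof -
      have "x \<in> L \<longleftrightarrow> - x \<in> {x. \<exists>H. \<forall>P\<in>\<P>. AE \<omega> in P. gain H S \<omega> + x \<ge> - ?f \<omega>}"
        unfolding L_def by (metis (no_types, lifting) image_iff minus_minus)
      then show ?thesis by (simp add: algebra_simps)
    qed
    have clU: "closed U" unfolding U_def by (rule closed_superhedging_prices[OF na])
    have clL: "closed L"
      unfolding L_def by (intro closed_negations closed_superhedging_prices[OF na])
    have U1: "1 \<in> U"
    proof -
      have "AE \<omega> in P. gain (\<lambda>_. 0) S \<omega> + 1 \<ge> ?f \<omega>" for P
        by (simp add: gain_def indicator_def)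
      then show ?thesis unfolding U_def by blast
    qed
    have L0: "x \<in> L" if "x \<le> 0" for x
    proof -
      have "AE \<omega> in P. gain (\<lambda>_. 0) S \<omega> + ?f \<omega> \<ge> x" for P
        using that by (simp add: gain_def indicator_def)
      then show ?thesis unfolding L_iff by blast
    qed
    have disj: "U \<inter> L = {}"
    proof (rule ccontr)
      assume "U \<inter> L \<noteq> {}"
      then obtain x where "x \<in> U" and xL: "x \<in> L" by blast
      then obtain H where H: "\<forall>P\<in>\<P>. AE \<omega> in P. gain H S \<omega> + x \<ge> ?f \<omega>"
        unfolding U_def by blast
      obtain K where K: "\<forall>P\<in>\<P>. AE \<omega> in P. gain K S \<omega> + ?f \<omega> \<ge> x"
        using xL unfolding L_iff by blast
      let ?G = "\<lambda>i. H i + 1 * K i"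
      have "AE \<omega> in P. gain ?G S \<omega> \<ge> 0" if "P \<in> \<P>" for P
        using bspec[OF H that] bspec[OF K that] unfolding gain_add_scaled by eventually_elim simp
      then have G: "\<forall>P\<in>\<P>. AE \<omega> in P. gain ?G S \<omega> = 0" by (intro na) blast
      have "AE \<omega> in P. gain H S \<omega> + x = ?f \<omega>" if "P \<in> \<P>" for P
        using bspec[OF H that] bspec[OF K that] bspec[OF G that]
        unfolding gain_add_scaled by eventually_elim simp
      then show False using False by blast
    qed
    have "\<not> UNIV \<subseteq> U \<union> L"
    proof
      assume "UNIV \<subseteq> U \<union> L"
      from connected_closedD[OF connected_UNIV _ this clU clL] have "U = {} \<or> L = {}"
        using disj by simp
      then show False using U1 L0[of 0] by auto
    qed
    then obtain x where x: "x \<notin> U" "x \<notin> L" by blast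
    have "x > 0" using L0[of x] x(2) by linarith
    moreover have "NA_qs M \<P> (digital_extension M S A x)"
    proof (rule NAext[OF \<open>x > 0\<close>])
      fix H :: "nat \<Rightarrow> real"
      define c where "c = H (dimension S)"
      assume "\<forall>P\<in>\<P>. AE \<omega> in P. gain H S \<omega> + H (dimension S) * (?f \<omega> - x) \<ge> 0"
      then have ge: "\<And>P. P \<in> \<P> \<Longrightarrow> AE \<omega> in P. gain H S \<omega> + c * (?f \<omega> - x) \<ge> 0"
        by (simp add: c_def)
      have "c = 0"
      proof (rule ccontr)
        assume "c \<noteq> 0"
        then consider "c > 0" | "c < 0" by linarith
        then show False
        proof cases
          case 1
          have "AE \<omega> in P. gain (\<lambda>i. inverse c * H i) S \<omega> + ?f \<omega> \<ge> x" if "P \<in> \<P>" for P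
            using ge[OF that] unfolding gain_scale
            by eventually_elim (use 1 in \<open>simp add: field_simps\<close>)
          then show False using x(2) unfolding L_iff by blast
        next
          case 2
          have "AE \<omega> in P. gain (\<lambda>i. - inverse c * H i) S \<omega> + x \<ge> ?f \<omega>" if "P \<in> \<P>" for P
            using ge[OF that] unfolding gain_scale
            by eventually_elim (use 2 in \<open>simp add: field_simps\<close>)
          then show False using x(1) unfolding U_def by blast
        qed
      qed
      then show "\<forall>P\<in>\<P>. AE \<omega> in P. gain H S \<omega> + H (dimension S) * (?f \<omega> - x) = 0"
        using na[of H] ge by (simp add: c_def)
    qed
    ultimately show ?thesis by blast
  qed
qed

section \<open>Domination by countably convex sets of measures\<close>

text \<open>A countable union of sets whose measures approach the supremum over \<open>\<C>\<close> attains it; a set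
  adding mass to this union would exceed the supremum.\<close>

lemma exhaustion:
  assumes "finite_measure P" and "\<C> \<subseteq> sets P" and "\<C> \<noteq> {}"
    and Un: "\<And>C :: nat \<Rightarrow> 'a set. range C \<subseteq> \<C> \<Longrightarrow> (\<Union>n. C n) \<in> \<C>"
  obtains C where "C \<in> \<C>" and "\<And>D. D \<in> \<C> \<Longrightarrow> emeasure P (D - C) = 0"
proof -
  interpret finite_measure P by fact
  obtain g :: "nat \<Rightarrow> ennreal" where g: "range g \<subseteq> emeasure P ` \<C>"
    "Sup (emeasure P ` \<C>) = Sup (range g)"
    using ennreal_SUP_countable_SUP[OF assms(3), of "emeasure P"] by metis
  then have "\<forall>n. \<exists>C\<in>\<C>. g n = emeasure P C" by blast
  then obtain C where C: "\<And>n. C n \<in> \<C>" "\<And>n. g n = emeasure P (C n)" by metis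
  let ?C = "\<Union>n. C n"
  have CC: "?C \<in> \<C>" using Un[of C] C(1) by blast
  then have CP: "?C \<in> sets P" using assms(2) by blast
  have top: "emeasure P D \<le> emeasure P ?C" if "D \<in> \<C>" for D
  proof -
    have "emeasure P D \<le> Sup (range g)" using that g(2) by (metis SUP_upper)
    also have "\<dots> \<le> emeasure P ?C"
      using CP by (auto intro!: Sup_least emeasure_mono simp: C(2))
    finally show ?thesis .
  qed
  show thesis
  proof (rule that[OF CC])
    fix D assume D: "D \<in> \<C>"
    then have DP: "D \<in> sets P" using assms(2) by blast
    have "(\<Union>n. (\<lambda>n::nat. if n = 0 then D else ?C) n) \<in> \<C>"
      using D CC by (intro Un) auto
    moreover have "(\<Union>n. (\<lambda>n::nat. if n = 0 then D else ?C) n) = ?C \<union> (D - ?C)"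
      by (auto split: if_splits)
    ultimately have "emeasure P (?C \<union> (D - ?C)) \<le> emeasure P ?C" using top by metis
    then have "emeasure P ?C + emeasure P (D - ?C) \<le> emeasure P ?C + 0"
      using CP DP by (subst plus_emeasure) auto
    then show "emeasure P (D - ?C) = 0"
      using emeasure_finite[of ?C] by (simp add: ennreal_add_left_cancel_le)
  qed
qed

text \<open>The sets on which \<open>P\<close> is dominated by an element of \<open>\<R>\<close> are closed under countable unions:
  mixing the dominating measures with positive weights dominates \<open>P\<close> on the union. Let \<open>C\<close> be
  a \<open>P\<close>-maximal set of this kind. If it missed some mass, then so would \<open>A = B - C\<close>, which is
  therefore charged by some \<open>Q \<in> \<R>\<close>. Removing from \<open>A\<close> a \<open>P\<close>-maximal \<open>Q\<close>-null subset \<open>N\<close> leaves a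
  set on which \<open>P\<close> is dominated by \<open>Q\<close>, so that \<open>A - N\<close> is \<open>P\<close>-null by maximality of \<open>C\<close>. But on
  \<open>B\<close> the measure \<open>P\<close> dominates \<open>Q\<close>, so \<open>A - N\<close> is also \<open>Q\<close>-null, and then so is \<open>A\<close>, a
  contradiction.\<close>

lemma dominating_measure_of_countably_convex:
  assumes P: "P \<in> prob_measures M" and RM: "\<R> \<subseteq> prob_measures M"
    and ne: "\<R> \<noteq> {}" and conv: "countably_convex M \<R>"
    and B: "B \<in> sets M" "emeasure P (space M - B) = 0"
    and supp: "\<And>Q N. Q \<in> \<R> \<Longrightarrow> N \<in> sets M \<Longrightarrow> N \<subseteq> B \<Longrightarrow> emeasure P N = 0 \<Longrightarrow> emeasure Q N = 0"
    and charge: "\<And>A. A \<in> sets M \<Longrightarrow> emeasure P A \<noteq> 0 \<Longrightarrow> \<exists>Q\<in>\<R>. emeasure Q A \<noteq> 0"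
  shows "\<exists>Q\<in>\<R>. absolutely_continuous Q P"
proof -
  have sP: "sets P = sets M" and spP: "space P = space M"
    using prob_measuresD[OF P] by auto
  interpret prob_space P by (rule prob_measuresD(1)[OF P])
  have sR: "sets Q = sets M" if "Q \<in> \<R>" for Q using RM that by (auto simp: prob_measures_def)
  define dom where "dom Q C \<longleftrightarrow> (\<forall>N\<in>sets M. N \<subseteq> C \<longrightarrow> emeasure Q N = 0 \<longrightarrow> emeasure P N = 0)" for Q C
  define \<C> where "\<C> = {C\<in>sets M. \<exists>Q\<in>\<R>. dom Q C}"
  have "{} \<in> \<C>" using ne by (auto simp: \<C>_def dom_def)
  moreover have Un: "(\<Union>n. C n) \<in> \<C>" if "range C \<subseteq> \<C>" for C :: "nat \<Rightarrow> 'a set"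
  proof -
    have "\<forall>n. \<exists>Q\<in>\<R>. dom Q (C n)" using that unfolding \<C>_def by blast
    then obtain Q where Q: "\<And>n. Q n \<in> \<R>" "\<And>n. dom (Q n) (C n)" by metis
    have CM: "C n \<in> sets M" for n using that by (auto simp: \<C>_def)
    let ?\<alpha> = "\<lambda>n. (1/2::real) ^ Suc n"
    let ?R = "mixture M ?\<alpha> Q"
    have "?R \<in> \<R>"
      using conv Q(1) power_half_series unfolding countably_convex_def by simp
    moreover have "dom ?R (\<Union>n. C n)"
      unfolding dom_def
    proof (intro ballI impI)
      fix N assume N: "N \<in> sets M" "N \<subseteq> (\<Union>n. C n)" "emeasure ?R N = 0"
      have "(\<Sum>n. ennreal (?\<alpha> n) * emeasure (Q n) N) = 0"
        using N emeasure_mixture[of Q M N ?\<alpha>] sR[OF Q(1)] by simp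
      then have "ennreal (?\<alpha> n) * emeasure (Q n) N = 0" for n by (simp add: suminf_eq_zero_iff)
      then have "emeasure (Q n) N = 0" for n
        by (metis ennreal_eq_0_iff mult_eq_0_iff not_le zero_less_power half_gt_zero zero_less_one)
      then have "emeasure (Q n) (N \<inter> C n) = 0" for n
        using N CM sR[OF Q(1)] emeasure_mono[of "N \<inter> C n" N "Q n"] by simp
      then have "emeasure P (N \<inter> C n) = 0" for n
        using Q(2)[of n] N CM unfolding dom_def by simp
      then have "emeasure P (\<Union>n. N \<inter> C n) = 0"
        using N CM sP by (intro emeasure_UN_eq_0) auto
      moreover have "(\<Union>n. N \<inter> C n) = N" using N(2) by auto
      ultimately show "emeasure P N = 0" by simp
    qed
    ultimately show ?thesis using CM unfolding \<C>_def by blast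
  qed
  moreover have "\<C> \<subseteq> sets P" using sP by (auto simp: \<C>_def)
  ultimately obtain C where C: "C \<in> \<C>" and Cmax: "\<And>D. D \<in> \<C> \<Longrightarrow> emeasure P (D - C) = 0"
    using exhaustion[OF finite_measure_axioms, of \<C>] by (metis empty_iff)
  have CM: "C \<in> sets M" using C by (simp add: \<C>_def)
  have full: "emeasure P (space M - C) = 0"
  proof (rule ccontr)
    assume n0: "emeasure P (space M - C) \<noteq> 0"
    define A where "A = B - C"
    have AM: "A \<in> sets M" using B CM by (simp add: A_def)
    have "emeasure P (space M - C) \<le> emeasure P (A \<union> (space M - B))"
      using AM B CM sP by (intro emeasure_mono) (auto simp: A_def)
    also have "\<dots> \<le> emeasure P A + emeasure P (space M - B)"
      using AM B sP by (intro emeasure_subadditive) auto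
    finally have "emeasure P A \<noteq> 0" using n0 B(2) by auto
    then obtain Q where Q: "Q \<in> \<R>" "emeasure Q A \<noteq> 0" using charge[OF AM] by blast
    define \<N> where "\<N> = {N\<in>sets M. N \<subseteq> A \<and> emeasure Q N = 0}"
    have "(\<Union>n. N n) \<in> \<N>" if "range N \<subseteq> \<N>" for N :: "nat \<Rightarrow> 'a set"
      using that sR[OF Q(1)] unfolding \<N>_def by (auto intro!: emeasure_UN_eq_0)
    moreover have "{} \<in> \<N>" by (auto simp: \<N>_def)
    moreover have "\<N> \<subseteq> sets P" using sP by (auto simp: \<N>_def)
    ultimately obtain N where N: "N \<in> \<N>" and Nmax: "\<And>D. D \<in> \<N> \<Longrightarrow> emeasure P (D - N) = 0"
      using exhaustion[OF finite_measure_axioms, of \<N>] by (metis empty_iff)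
    have NM: "N \<in> sets M" "N \<subseteq> A" "emeasure Q N = 0" using N by (auto simp: \<N>_def)
    have "dom Q (A - N)"
      unfolding dom_def
    proof (intro ballI impI)
      fix D assume D: "D \<in> sets M" "D \<subseteq> A - N" "emeasure Q D = 0"
      then have "emeasure P (D - N) = 0" using Nmax[of D] by (auto simp: \<N>_def)
      moreover have "D - N = D" using D(2) by auto
      ultimately show "emeasure P D = 0" by simp
    qed
    then have "A - N \<in> \<C>" using Q AM NM unfolding \<C>_def by blast
    from Cmax[OF this] have "emeasure P (A - N - C) = 0" .
    moreover have "A - N - C = A - N" by (auto simp: A_def)
    ultimately have "emeasure P (A - N) = 0" by simp
    then have "emeasure Q (A - N) = 0"
      using supp[OF Q(1), of "A - N"] AM NM by (auto simp: A_def)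
    moreover have "emeasure Q A \<le> emeasure Q (A - N) + emeasure Q N"
      using emeasure_subadditive[of "A - N" Q N] AM NM sR[OF Q(1)]
      by (metis Diff_partition Un_commute sets.Diff)
    ultimately show False using Q(2) NM by simp
  qed
  obtain Q where Q: "Q \<in> \<R>" "dom Q C" using C by (auto simp: \<C>_def)
  have "absolutely_continuous Q P"
    unfolding absolutely_continuous_def
  proof
    fix N assume "N \<in> null_sets Q"
    then have N: "N \<in> sets M" "emeasure Q N = 0" using sR[OF Q(1)] by (auto simp: null_sets_def)
    have "emeasure Q (N \<inter> C) = 0"
      using N CM sR[OF Q(1)] emeasure_mono[of "N \<inter> C" N Q] by simp
    then have "emeasure P (N \<inter> C) = 0" using Q(2) N CM unfolding dom_def by simp
    moreover have "emeasure P N \<le> emeasure P ((N \<inter> C) \<union> (space M - C))"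
      using N CM sP sets.sets_into_space[OF N(1)] by (intro emeasure_mono) auto
    moreover have "\<dots> \<le> emeasure P (N \<inter> C) + emeasure P (space M - C)"
      using N CM sP by (intro emeasure_subadditive) auto
    ultimately show "N \<in> null_sets P" using full N sP by (simp add: null_sets_def)
  qed
  then show ?thesis using Q(1) by blast
qed

section \<open>Martingale measures and the fundamental theorem\<close>

lemma increment_integrable:
  assumes "S \<in> markets M" and "Q \<in> prob_measures M" and "i < dimension S"
  shows "integrable Q (increment S i)"
proof -
  interpret prob_space Q by (rule prob_measuresD(1)[OF assms(2)])
  note sQ = prob_measuresD(2,3)[OF assms(2)]
  have "bounded (price1 S i ` space M)" using assms(1,3) by (auto simp: markets_def)
  then obtain b where b: "\<And>\<omega>. \<omega> \<in> space M \<Longrightarrow> \<bar>price1 S i \<omega>\<bar> \<le> b"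
    unfolding bounded_iff by auto
  have "AE \<omega> in Q. norm (increment S i \<omega>) \<le> b + \<bar>price0 S i\<bar>"
  proof (rule AE_I2)
    fix \<omega> assume "\<omega> \<in> space Q"
    then show "norm (increment S i \<omega>) \<le> b + \<bar>price0 S i\<bar>"
      using b[of \<omega>] sQ by (simp add: increment_def)
  qed
  moreover have "increment S i \<in> borel_measurable Q"
    using increment_measurable[OF assms(1,3)] measurable_cong_sets[OF sQ(1) refl] by blast
  ultimately show ?thesis by (rule integrable_const_bound)
qed

lemma martingale_measure_NA:
  assumes S: "S \<in> markets M" and Q: "Q \<in> martingale_measures M \<P> S"
  shows "NA Q S"
  unfolding NA_def
proof (intro allI impI)
  fix H assume ge: "AE \<omega> in Q. gain H S \<omega> \<ge> 0"
  have QM: "Q \<in> prob_measures M"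
    using Q by (simp add: martingale_measures_def prob_measures_c_def)
  have int: "integrable Q (\<lambda>\<omega>. H i * increment S i \<omega>)" if "i < dimension S" for i
    using increment_integrable[OF S QM that] by simp
  then have "integrable Q (gain H S)"
    unfolding gain_def by (intro Bochner_Integration.integrable_sum) auto
  moreover have "(\<integral>\<omega>. gain H S \<omega> \<partial>Q) = 0"
    using Q int unfolding gain_def by (subst Bochner_Integration.integral_sum)
      (auto simp: martingale_measures_def)
  ultimately show "AE \<omega> in Q. gain H S \<omega> = 0"
    using integral_nonneg_eq_0_iff_AE[of Q "gain H S"] ge by simp
qed

theorem theorem4p35:
  fixes M :: "'a measure"
    and \<P> :: "'a measure set"
    and \<QQ> :: "'a market \<Rightarrow> 'a measure set"
  assumes "\<P> \<noteq> {}" and "\<P> \<subseteq> prob_measures M"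
    and "\<And>P. P \<in> \<P> \<Longrightarrow> supported M \<P> P"
    and "\<And>S. S \<in> markets M \<Longrightarrow> \<QQ> S \<subseteq> prob_measures_c M \<P>"
    and "submarket_monotone M \<QQ>"
    and "strongly_NA_preserving M \<P> \<QQ>"
    and "\<And>S. S \<in> markets M \<Longrightarrow> countably_convex M (\<QQ> S)"
    and "\<And>S. S \<in> markets M \<Longrightarrow> (\<Union>Q\<in>\<QQ> S. equiv_martingale_measures M \<P> Q S) \<subseteq> \<QQ> S"
    and "\<And>S. S \<in> markets M \<Longrightarrow> \<QQ> S \<subseteq> martingale_measures M \<P> S"
  shows "\<forall>S\<in>markets M.
    NA_qs M \<P> S \<longleftrightarrow> (\<forall>P\<in>\<P>. \<exists>Q\<in>\<QQ> S. absolutely_continuous Q P)"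
proof
  fix S assume S: "S \<in> markets M"
  note PM = assms(2)
  have mart: "Q \<in> martingale_measures M \<P> S'" if "S' \<in> markets M" "Q \<in> \<QQ> S'" for Q S'
    using assms(9) that by blast
  have mono: "\<QQ> S' \<subseteq> \<QQ> S" if "S' \<in> markets M" "S \<lhd>\<^sub>m S'" for S'
    using assms(5) S that unfolding submarket_monotone_def by blast
  have ne: "\<QQ> S' \<noteq> {}" if "S' \<in> markets M" "NA_qs M \<P> S'" for S'
    using assms(6) that unfolding strongly_NA_preserving_def by blast
  show "NA_qs M \<P> S \<longleftrightarrow> (\<forall>P\<in>\<P>. \<exists>Q\<in>\<QQ> S. absolutely_continuous Q P)"
  proof
    assume ac: "\<forall>P\<in>\<P>. \<exists>Q\<in>\<QQ> S. absolutely_continuous Q P"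
    have meas: "{\<omega>\<in>space M. gain H S \<omega> = 0} \<in> sets M" for H
      using gain_measurable[OF S, of H] by measurable
    show "NA_qs M \<P> S"
      unfolding NA_qs_def
    proof (intro allI impI)
      fix H assume "quasi_surely M \<P> (\<lambda>\<omega>. gain H S \<omega> \<ge> 0)"
      then obtain N where N: "polar M \<P> N" "\<And>\<omega>. \<omega> \<in> space M - N \<Longrightarrow> gain H S \<omega> \<ge> 0"
        unfolding quasi_surely_def by blast
      have "AE \<omega> in P. gain H S \<omega> = 0" if P: "P \<in> \<P>" for P
      proof -
        obtain Q where Q: "Q \<in> \<QQ> S" "absolutely_continuous Q P" using ac P by blast
        have "Q \<in> prob_measures_c M \<P>" using assms(4)[OF S] Q(1) by blast
        then have sQ: "sets Q = sets M" and QN: "emeasure Q N = 0"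
          using N(1) by (auto simp: prob_measures_c_def prob_measures_def)
        have "AE \<omega> in Q. gain H S \<omega> \<ge> 0"
        proof (rule AE_I)
          show "{\<omega>\<in>space Q. \<not> gain H S \<omega> \<ge> 0} \<subseteq> N"
            using N(2) sets_eq_imp_space_eq[OF sQ] by blast
          show "N \<in> sets Q" using N(1) sQ by (simp add: polar_def)
        qed (rule QN)
        then have AEQ: "AE \<omega> in Q. gain H S \<omega> = 0"
          using martingale_measure_NA[OF S mart[OF S Q(1)]] unfolding NA_def by blast
        have "sets P = sets Q" using PM P sQ by (auto simp: prob_measures_def)
        then show ?thesis using absolutely_continuous_AE[OF _ Q(2) AEQ] by simp
      qed
      then show "quasi_surely M \<P> (\<lambda>\<omega>. gain H S \<omega> = 0)"
        by (simp add: quasi_surely_iff_AE[OF PM meas])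
    qed
  next
    assume NA: "NA_qs M \<P> S"
    show "\<forall>P\<in>\<P>. \<exists>Q\<in>\<QQ> S. absolutely_continuous Q P"
    proof
      fix P assume P: "P \<in> \<P>"
      obtain B where B: "B \<in> sets M" "emeasure P (space M - B) = 0"
        "\<And>N. N \<in> sets M \<Longrightarrow> emeasure P N = 0 \<Longrightarrow> polar M \<P> (N \<inter> B)"
        using assms(3)[OF P] unfolding supported_def by blast
      show "\<exists>Q\<in>\<QQ> S. absolutely_continuous Q P"
      proof (rule dominating_measure_of_countably_convex[OF _ _ ne[OF S NA] assms(7)[OF S] B(1,2)])
        show "P \<in> prob_measures M" using P PM by blast
        show "\<QQ> S \<subseteq> prob_measures M" using assms(4)[OF S] by (auto simp: prob_measures_c_def)
        show "emeasure Q N = 0"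
          if "Q \<in> \<QQ> S" "N \<in> sets M" "N \<subseteq> B" "emeasure P N = 0" for Q N
        proof -
          have "polar M \<P> N" using B(3)[of N] that by (simp add: Int_absorb2)
          then show ?thesis using assms(4)[OF S] that(1) by (auto simp: prob_measures_c_def)
        qed
        show "\<exists>Q\<in>\<QQ> S. emeasure Q A \<noteq> 0" if A: "A \<in> sets M" "emeasure P A \<noteq> 0" for A
        proof -
          obtain x where x: "x > 0" "NA_qs M \<P> (digital_extension M S A x)"
            using ex_arbitrage_free_digital_price[OF PM S NA A(1) P A(2)] by blast
          define S' where "S' = digital_extension M S A x"
          have S': "S' \<in> markets M"
            using digital_extension_in_markets[OF S A(1)] x(1) by (simp add: S'_def)
          obtain Q where Q: "Q \<in> \<QQ> S'" using ne[OF S'] x(2) by (auto simp: S'_def)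
          have QS: "Q \<in> \<QQ> S" using mono[OF S'] Q by (auto simp: S'_def submarket_digital_extension)
          have QM: "prob_space Q" "sets Q = sets M"
            using assms(4)[OF S] QS by (auto simp: prob_measures_c_def prob_measures_def)
          interpret prob_space Q by (rule QM(1))
          have "dimension S < dimension S'" by (simp add: S'_def digital_extension_def)
          then have "(\<integral>\<omega>. increment S' (dimension S) \<omega> \<partial>Q) = 0"
            using mart[OF S' Q] by (auto simp: martingale_measures_def)
          moreover have "(\<integral>\<omega>. increment S' (dimension S) \<omega> \<partial>Q) = (\<integral>\<omega>. indicator A \<omega> - x \<partial>Q)"
            by (rule Bochner_Integration.integral_cong) (auto simp: S'_def digital_extension_def
                increment_def price0_def price1_def sets_eq_imp_space_eq[OF QM(2)])
          moreover have "(\<integral>\<omega>. indicator A \<omega> - x \<partial>Q) = measure Q A - x"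
            using A(1) QM(2) by (subst Bochner_Integration.integral_diff)
              (auto simp: prob_space emeasure_eq_measure sets.Int_space_eq2)
          ultimately have "measure Q A > 0" using x(1) by simp
          then have "emeasure Q A \<noteq> 0" by (simp add: emeasure_eq_measure)
          then show ?thesis using QS by blast
        qed
      qed
    qed
  qed
qed

end
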